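(* Let $K\subset\mathbb{R}^m$ be a closed, convex, pointed cone with nonempty interior, let $C\subseteq\mathbb{R}^n$ be a nonempty closed convex set, and let $F:\mathbb{R}^n\to\mathbb{R}^m$ be continuously differentiable. Let $(x^k)_{k\in\mathbb{N}}$, $(v^k)_{k\in\mathbb{N}}$, $(t_k)_{k\in\mathbb{N}}$ be infinite sequences generated by the inexact projected gradient method (described in the context) applied to $F$, $C$, $K$, and suppose that: (1) the set $T:=\{x\in C : F(x)\preceq_K F(x^k)\ \text{for all } k=0,1,\ldots\}$ is nonempty; (2) there exists a sequence $(\omega^k)_{k\in\mathbb{N}}\subset\mathrm{conv}(G)$ such that $v^k=P_{C-x^k}\bigl(-\hat\beta J_F(x^k)^T\omega^k\bigr)$ for all $k=0,1,\ldots$. Assume that $F$ is $K$-quasiconvex. Then $(x^k)_{k\in\mathbb{N}}$ converges to a stationary point.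
   Context: Order: $u\preceq_K v$ means $v-u\in K$, and $u\prec_K v$ means $v-u\in\mathrm{int}(K)$. The positive polar cone is $K^\star=\{y\in\mathbb{R}^m:\langle y,x\rangle\ge 0\ \text{for all }x\in K\}$. $G\subset K^\star\setminus\{0\}$ is a fixed compact set such that $K^\star$ is the cone generated by $\mathrm{conv}(G)$, the convex hull of $G$. $J_F(x)$ is the Jacobian matrix of $F$ at $x$, $C-x=\{y-x: y\in C\}$, and $P_{C-x}$ is the orthogonal (Euclidean) projection onto $C-x$. $K$-quasiconvexity: $F$ is $K$-quasiconvex if for every $y\in\mathbb{R}^m$ the set $\{x\in\mathbb{R}^n: F(x)\preceq_K y\}$ is convex. Stationarity: $x^*\in C$ is a stationary point (of the problem $\min_K F(x)$ s.t. $x\in C$) if $-\mathrm{int}(K)\cap J_F(x^* )(C-x^* )=\emptyset$. Approximate directions: fix $\hat\beta>0$. Let $\varphi(y)=\max_{\omega\in G}\langle y,\omega\rangle$ for $y\in\mathbb{R}^m$, and for $x\in C$, $v\in C-x$, let $h_x(v)=\hat\beta\,\varphi(J_F(x)v)+\|v\|^2/2$. Let $\theta(x)=\min_{v\in C-x}h_x(v)$. For $\sigma\in[0,1)$, a vector $v\in C-x$ is a $\sigma$-approximate projected gradient direction at $x$ if $h_x(v)\le(1-\sigma)\theta(x)$. Inexact projected gradient method: fix $\hat\beta>0$, $\delta\in(0,1)$, $\tau>1$, $\sigma\in[0,1)$. Take $x^0\in C$. Given $x^k$, compute a $\sigma$-approximate projected gradient direction $v^k$ at $x^k$. If $h_{x^k}(v^k)=0$,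 stop. Otherwise let $j(k)=\min\{j\in\mathbb{Z}_+: F(x^k+\tau^{-j}v^k)\preceq_K F(x^k)+\delta\tau^{-j}J_F(x^k)v^k\}$, set $t_k=\tau^{-j(k)}$ and $x^{k+1}=x^k+t_kv^k$. Infinite sequences are those obtained when the method never stops. *)

theory Defs
  imports "HOL-Analysis.Analysis"
begin

definition cone_le :: "(real^'m) set \<Rightarrow> real^'m \<Rightarrow> real^'m \<Rightarrow> bool" where
  "cone_le K u v \<longleftrightarrow> v - u \<in> K"

definition pointed :: "(real^'m) set \<Rightarrow> bool" where
  "pointed K \<longleftrightarrow> K \<inter> uminus ` K = {0}"

definition polar_cone :: "(real^'m) set \<Rightarrow> (real^'m) set" where
  "polar_cone K = {y. \<forall>x\<in>K. 0 \<le> inner y x}"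

definition continuously_differentiable :: "(real^'n \<Rightarrow> real^'m) \<Rightarrow> bool" where
  "continuously_differentiable F \<longleftrightarrow>
     (\<forall>x. F differentiable (at x)) \<and> continuous_on UNIV (\<lambda>x. jacobian F (at x))"

definition K_quasiconvex :: "(real^'m) set \<Rightarrow> (real^'n \<Rightarrow> real^'m) \<Rightarrow> bool" where
  "K_quasiconvex K F \<longleftrightarrow> (\<forall>y. convex {x. cone_le K (F x) y})"

abbreviation shift :: "(real^'n) set \<Rightarrow> real^'n \<Rightarrow> (real^'n) set" where
  "shift C x \<equiv> (\<lambda>y. y - x) ` C"

definition stationary ::
  "(real^'m) set \<Rightarrow> (real^'n) set \<Rightarrow> (real^'n \<Rightarrow> real^'m) \<Rightarrow> real^'n \<Rightarrow> bool" where
  "stationary K C F x \<longleftrightarrow> x \<in> C \<and>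
     uminus ` interior K \<inter> (\<lambda>v. jacobian F (at x) *v v) ` shift C x = {}"

definition phi :: "(real^'m) set \<Rightarrow> real^'m \<Rightarrow> real" where
  "phi G y = (SUP w\<in>G. inner y w)"

definition hfun ::
  "(real^'m) set \<Rightarrow> (real^'n \<Rightarrow> real^'m) \<Rightarrow> real \<Rightarrow> real^'n \<Rightarrow> real^'n \<Rightarrow> real" where
  "hfun G F \<beta> x v = \<beta> * phi G (jacobian F (at x) *v v) + (norm v)\<^sup>2 / 2"

definition theta ::
  "(real^'m) set \<Rightarrow> (real^'n) set \<Rightarrow> (real^'n \<Rightarrow> real^'m) \<Rightarrow> real \<Rightarrow> real^'n \<Rightarrow> real" where
  "theta G C F \<beta> x = (INF v\<in>shift C x. hfun G F \<beta> x v)"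

text \<open>The supremum in \<open>phi\<close> and the infimum in \<open>theta\<close> are attained for compact nonempty \<open>G\<close>
  and closed \<open>C\<close>, so they are a maximum and a minimum.\<close>

lemma phi_attained:
  assumes "compact G" "G \<noteq> {}"
  shows "\<exists>w\<in>G. phi G y = inner y w \<and> (\<forall>u\<in>G. inner y u \<le> inner y w)"
proof -
  have "continuous_on G (inner y)" by (intro continuous_intros)
  then obtain w where w: "w \<in> G" "\<forall>u\<in>G. inner y u \<le> inner y w"
    using continuous_attains_sup[OF assms] by blast
  have "phi G y = inner y w"
    unfolding phi_def using w by (intro cSup_eq_maximum) auto
  with w show ?thesis by blast
qed

lemma phi_upper:
  assumes "compact G" "u \<in> G"
  shows "inner y u \<le> phi G y"
  using phi_attained[of G y] assms by fastforce

lemma continuous_on_phi: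
  assumes "compact G" "G \<noteq> {}"
  shows "continuous_on UNIV (phi G)"
proof (rule convex_on_continuous)
  show "convex_on UNIV (phi G)"
  proof (rule convex_onI)
    fix t :: real and x y assume t: "0 < t" "t < 1"
    obtain w where w: "w \<in> G" "phi G ((1 - t) *\<^sub>R x + t *\<^sub>R y) = inner ((1 - t) *\<^sub>R x + t *\<^sub>R y) w"
      using phi_attained[OF assms] by blast
    have "inner x w \<le> phi G x" "inner y w \<le> phi G y" using phi_upper[OF assms(1) w(1)] by auto
    with t have "(1 - t) * inner x w + t * inner y w \<le> (1 - t) * phi G x + t * phi G y"
      by (intro add_mono mult_left_mono) auto
    with w show "phi G ((1 - t) *\<^sub>R x + t *\<^sub>R y) \<le> (1 - t) * phi G x + t * phi G y"
      by (simp add: inner_add_left)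
  qed auto
qed auto

lemma theta_attained:
  assumes G: "compact G" "G \<noteq> {}" and C: "closed C" "x \<in> C" and \<beta>: "\<beta> > 0"
  shows "\<exists>v\<in>shift C x. theta G C F \<beta> x = hfun G F \<beta> x v
           \<and> (\<forall>u\<in>shift C x. hfun G F \<beta> x v \<le> hfun G F \<beta> x u)"
proof -
  let ?A = "jacobian F (at x)" and ?h = "hfun G F \<beta> x"
  obtain w where w: "w \<in> G" using G by auto
  define R where "R = 2 * norm (\<beta> *\<^sub>R (transpose ?A *v w))"
  have h0: "?h 0 = 0"
    using phi_attained[OF G, of 0] by (auto simp: hfun_def)
  have pos: "0 \<le> ?h v" if "norm v \<ge> R" for v
  proof -
    have "inner (?A *v v) w = inner v (transpose ?A *v w)"
      by (metis dot_lmul_matrix inner_commute transpose_matrix_vector)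
    then have "\<beta> * inner (?A *v v) w = inner v (\<beta> *\<^sub>R (transpose ?A *v w))" by simp
    moreover have "\<bar>inner v (\<beta> *\<^sub>R (transpose ?A *v w))\<bar> \<le> norm v * (R / 2)"
      unfolding R_def using Cauchy_Schwarz_ineq2[of v "\<beta> *\<^sub>R (transpose ?A *v w)"]
    by (simp del: inner_scaleR_right norm_scaleR)
    moreover have "norm v * (R / 2) \<le> (norm v)\<^sup>2 / 2"
      using that by (simp add: power2_eq_square mult_left_mono)
    moreover have "\<beta> * inner (?A *v v) w \<le> \<beta> * phi G (?A *v v)"
      using phi_upper[OF G(1) w] \<beta> by (simp add: mult_left_mono)
    ultimately show ?thesis unfolding hfun_def by linarith
  qed
  let ?S = "shift C x \<inter> cball 0 R"
  have "closed (shift C x)" using closed_translation[OF C(1), of "- x"] by simp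
  then have "compact ?S" by (simp add: closed_Int_compact)
  moreover have 0: "0 \<in> ?S" using C by (auto simp: R_def)
  moreover have "continuous_on UNIV (\<lambda>v. ?A *v v)"
    by (simp add: linear_continuous_on linear_linear)
  then have "continuous_on UNIV (\<lambda>v. phi G (?A *v v))"
    using continuous_on_compose2[OF continuous_on_phi[OF G]] by blast
  then have "continuous_on ?S ?h"
    unfolding hfun_def by (intro continuous_intros) (auto intro: continuous_on_subset)
  ultimately obtain v where v: "v \<in> ?S" "\<forall>u\<in>?S. ?h v \<le> ?h u"
    using continuous_attains_inf[of ?S ?h] by blast
  have least: "?h v \<le> ?h u" if "u \<in> shift C x" for u
  proof (cases "norm u \<le> R")
    case True with v that show ?thesis by auto
  next
    case False
    with pos have "0 \<le> ?h u" by simp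
    moreover have "?h v \<le> 0" using v(2) 0 h0 by metis
    ultimately show ?thesis by linarith
  qed
  then have "theta G C F \<beta> x = ?h v"
    unfolding theta_def using v by (intro cInf_eq_minimum) auto
  with least v show ?thesis by blast
qed

definition approx_direction ::
  "(real^'m) set \<Rightarrow> (real^'n) set \<Rightarrow> (real^'n \<Rightarrow> real^'m) \<Rightarrow> real \<Rightarrow> real \<Rightarrow> real^'n \<Rightarrow> real^'n \<Rightarrow> bool"
where
  "approx_direction G C F \<beta> \<sigma> x v \<longleftrightarrow>
     v \<in> shift C x \<and> hfun G F \<beta> x v \<le> (1 - \<sigma>) * theta G C F \<beta> x"

definition armijo ::
  "(real^'m) set \<Rightarrow> (real^'n \<Rightarrow> real^'m) \<Rightarrow> real \<Rightarrow> real^'n \<Rightarrow> real^'n \<Rightarrow> real \<Rightarrow> bool" where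
  "armijo K F \<delta> x v s \<longleftrightarrow>
     cone_le K (F (x + s *\<^sub>R v)) (F x + (\<delta> * s) *\<^sub>R (jacobian F (at x) *v v))"

text \<open>Infinite runs of the method. The natural number \<open>j\<close> is the minimal exponent accepted by
  the line search at step \<open>k\<close>, and \<open>hfun \<dots> \<noteq> 0\<close> says that the stopping test fails at step \<open>k\<close>.\<close>

definition inexact_projected_gradient ::
  "(real^'m) set \<Rightarrow> (real^'m) set \<Rightarrow> (real^'n) set \<Rightarrow> (real^'n \<Rightarrow> real^'m) \<Rightarrow>
   real \<Rightarrow> real \<Rightarrow> real \<Rightarrow> real \<Rightarrow>
   (nat \<Rightarrow> real^'n) \<Rightarrow> (nat \<Rightarrow> real^'n) \<Rightarrow> (nat \<Rightarrow> real) \<Rightarrow> bool"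
where
  "inexact_projected_gradient K G C F \<beta> \<delta> \<tau> \<sigma> x v t \<longleftrightarrow>
     x 0 \<in> C \<and>
     (\<forall>k. approx_direction G C F \<beta> \<sigma> (x k) (v k) \<and>
          hfun G F \<beta> (x k) (v k) \<noteq> 0 \<and>
          (\<exists>j::nat. armijo K F \<delta> (x k) (v k) (\<tau> powi (- int j)) \<and>
             (\<forall>i<j. \<not> armijo K F \<delta> (x k) (v k) (\<tau> powi (- int i))) \<and>
             t k = \<tau> powi (- int j)) \<and>
          x (Suc k) = x k + t k *\<^sub>R v k)"

end

theory Submission
  imports Defs
begin

text \<open>
  The vectors \<open>y k = - t k \<cdot> J(x k) v k\<close> lie in \<open>K\<close>, and by the line search their sum is bounded
  in the order of \<open>K\<close> by a multiple of \<open>F (x 0) - F z\<close> for any \<open>z\<close> in the set \<open>T\<close> of common lower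
  points. Since \<open>K\<close> is pointed, some polar functional dominates the norm on \<open>K\<close>, so the norms of
  \<open>y k\<close> are summable. By quasiconvexity \<open>J(x k) (z - x k) \<in> - K\<close>, and the projection inequality for
  \<open>v k\<close> then shows that \<open>x\<close> is quasi-Fejer monotone with respect to \<open>T\<close>, with errors a multiple of
  \<open>norm (y k)\<close>. A cluster point belongs to \<open>T\<close>, so the whole sequence converges to it. If the limit
  were not stationary, \<open>phi G (J(x k) v k)\<close> would eventually stay below a negative constant, so
  \<open>t k\<close> would tend to 0; but then strict differentiability of \<open>F\<close> at the limit makes the rejected
  step \<open>\<tau> \<cdot> t k\<close> acceptable.
\<close>

lemma polar_coneD: "w \<in> polar_cone K \<Longrightarrow> y \<in> K \<Longrightarrow> 0 \<le> inner y w"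
  by (metis (mono_tags, lifting) inner_commute mem_Collect_eq polar_cone_def)

text \<open>The nontrivial half of the bipolar theorem. If \<open>y\<close> were outside
  \<open>K\<close>, a separating functional \<open>a\<close> would have to be nonnegative on the
  cone, hence polar, yet negative at \<open>y\<close>.\<close>

lemma mem_cone_if_polar_nonneg:
  assumes K: "closed K" "convex_cone K" and y: "\<And>w. w \<in> polar_cone K \<Longrightarrow> 0 \<le> inner y w"
  shows "y \<in> K"
proof (rule ccontr)
  assume "y \<notin> K"
  then obtain a b where ab: "inner a y < b" "\<forall>x\<in>K. inner a x > b"
    using separating_hyperplane_closed_point[of K y] K by (auto simp: convex_cone_def)
  have "0 \<in> K" using K(2) by (auto simp: convex_cone_def conic_contains_0)
  with ab have b: "b < 0" by force
  have "0 \<le> inner a x" if "x \<in> K" for x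
  proof (rule ccontr)
    assume neg: "\<not> 0 \<le> inner a x"
    \<comment> \<open>Both \<open>b\<close> and \<open>inner a x\<close> are negative, so the factor
      is positive; it rescales \<open>x\<close> to have pairing exactly \<open>b\<close> with
      \<open>a\<close>, against the strict separation.\<close>
    have "(b / inner a x) *\<^sub>R x \<in> K"
      using K(2) that neg b by (auto simp: convex_cone_def conic_def divide_nonpos_neg)
    with ab(2) have "inner a ((b / inner a x) *\<^sub>R x) > b" by blast
    with neg show False by simp
  qed
  then have "a \<in> polar_cone K" by (simp add: polar_cone_def)
  with y ab b show False by (force simp: inner_commute)
qed

text \<open>Nonnegativity against \<open>y\<close> survives convex combinations and nonnegative
  scaling, so it spreads from \<open>G\<close> to the whole polar cone. This turns statements about
  the order of \<open>K\<close> into bounds on \<open>phi G\<close>.\<close>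

lemma mem_cone_iff_generator:
  assumes K: "closed K" "convex_cone K" and gen: "polar_cone K = conic hull (convex hull G)"
  shows "y \<in> K \<longleftrightarrow> (\<forall>w\<in>G. 0 \<le> inner y w)"
proof
  have "G \<subseteq> polar_cone K"
    unfolding gen using hull_subset[of G convex] hull_subset[of "convex hull G" conic] by blast
  then show "\<forall>w\<in>G. 0 \<le> inner y w" if "y \<in> K"
    using that polar_coneD by blast
next
  assume G: "\<forall>w\<in>G. 0 \<le> inner y w"
  have "convex {w. inner y w \<ge> 0}" using convex_halfspace_ge[of 0 y] by simp
  then have "convex hull G \<subseteq> {w. inner y w \<ge> 0}" using G by (intro hull_minimal) auto
  then have "conic hull (convex hull G) \<subseteq> {w. inner y w \<ge> 0}"
    by (rule hull_minimal) (auto simp: conic_def)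
  then show "y \<in> K"
    by (intro mem_cone_if_polar_nonneg[OF K]) (auto simp: gen)
qed

text \<open>From an interior point a short move along \<open>- w\<close> stays in \<open>K\<close>
  and lowers the pairing with \<open>w\<close> by a positive amount, while the result is still
  nonnegative.\<close>

lemma inner_interior_pos:
  assumes "y \<in> interior K" "w \<in> polar_cone K" "w \<noteq> 0"
  shows "0 < inner y w"
proof -
  obtain e where e: "e > 0" "cball y e \<subseteq> K"
    using assms(1) mem_interior_cball by blast
  let ?d = "e / norm w"
  have "y - ?d *\<^sub>R w \<in> K" using e assms(3) by (auto simp: dist_norm)
  then have "0 \<le> inner (y - ?d *\<^sub>R w) w" using polar_coneD assms(2) by blast
  moreover have "0 < ?d * inner w w" using e assms(3) by simp
  ultimately show ?thesis by (simp add: inner_diff_left)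
qed

lemma phi_neg_if_interior:
  assumes "compact G" "G \<noteq> {}" "G \<subseteq> polar_cone K - {0}" "- y \<in> interior K"
  shows "phi G y < 0"
proof -
  obtain w where w: "w \<in> G" "phi G y = inner y w" using phi_attained assms(1,2) by blast
  with inner_interior_pos[OF assms(4), of w] assms(3) show ?thesis by auto
qed

text \<open>Pointedness makes \<open>K - {0}\<close> convex, so the compact convex hull of the unit
  vectors of \<open>K\<close> misses 0. Strict separation from 0 bounds a functional below on unit
  vectors, and homogeneity does the rest.\<close>

lemma pointed_coercive_functional:
  fixes K :: "(real^'m) set"
  assumes K: "closed K" "convex_cone K" "pointed K"
  obtains w c where "c > 0" "w \<in> polar_cone K" "\<And>y. y \<in> K \<Longrightarrow> c * norm y \<le> inner y w"
proof -
  let ?S = "K \<inter> sphere 0 1"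
  have cone: "u *\<^sub>R a \<in> K" if "u \<ge> 0" "a \<in> K" for u a
    using K(2) that by (auto simp: convex_cone_def conic_def)
  have "convex (K - {0})"
  proof (rule convexI)
    fix a b and u v :: real
    assume ab: "a \<in> K - {0}" "b \<in> K - {0}" and uv: "0 \<le> u" "0 \<le> v" "u + v = 1"
    have "u *\<^sub>R a + v *\<^sub>R b \<in> K" using K(2) ab uv cone by (simp add: convex_cone_add)
    moreover have "u *\<^sub>R a + v *\<^sub>R b \<noteq> 0"
    proof
      assume z: "u *\<^sub>R a + v *\<^sub>R b = 0"
      then have "u *\<^sub>R a = - (v *\<^sub>R b)" by (simp add: add_eq_0_iff2)
      then have "u *\<^sub>R a \<in> uminus ` K" using ab(2) uv(2) cone[of v b] by blast
      moreover have "u *\<^sub>R a \<in> K" using ab(1) uv(1) cone[of u a] by blast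
      ultimately have "u *\<^sub>R a = 0" using K(3) unfolding pointed_def by blast
      with z ab uv show False by (cases "u = 0") auto
    qed
    ultimately show "u *\<^sub>R a + v *\<^sub>R b \<in> K - {0}" by simp
  qed
  then have "convex hull ?S \<subseteq> K - {0}" by (intro hull_minimal) auto
  moreover have "compact (convex hull ?S)"
    using K(1) by (simp add: closed_Int_compact compact_convex_hull)
  ultimately obtain w c where wc: "c > 0" "\<forall>y\<in>convex hull ?S. inner w y > c"
    using separating_hyperplane_closed_0[OF convex_convex_hull compact_imp_closed, of ?S] by blast
  have *: "c * norm y \<le> inner y w" if "y \<in> K" for y
  proof (cases "y = 0")
    case False
    then have "(1 / norm y) *\<^sub>R y \<in> ?S" using cone[of "1 / norm y", OF _ that] by simp
    then have "inner w ((1 / norm y) *\<^sub>R y) > c" using wc(2) hull_inc by metis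
    with False show ?thesis by (simp add: field_simps inner_commute)
  qed simp
  moreover have "w \<in> polar_cone K"
    unfolding polar_cone_def
  proof safe
    fix y assume "y \<in> K"
    with * wc(1) have "0 \<le> c * norm y" "c * norm y \<le> inner y w" by auto
    then show "0 \<le> inner w y" by (simp add: inner_commute)
  qed
  ultimately show ?thesis using wc(1) that by blast
qed

text \<open>Subtracting the accumulated errors leaves a decreasing sequence bounded below by minus
  their total.\<close>

lemma quasi_decreasing_convergent:
  fixes a e :: "nat \<Rightarrow> real"
  assumes a: "\<And>k. 0 \<le> a k" and e: "\<And>k. 0 \<le> e k" "summable e"
    and step: "\<And>k. a (Suc k) \<le> a k + e k"
  shows "convergent a"
proof -
  define b where "b k = a k - (\<Sum>i<k. e i)" for k
  have "decseq b" using step by (intro decseq_SucI) (simp add: b_def algebra_simps)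
  moreover have "- suminf e \<le> b k" for k
    using a[of k] sum_le_suminf[OF e(2), of "{..<k}"] e(1) by (simp add: b_def)
  ultimately obtain L where "b \<longlonglongrightarrow> L" using decseq_convergent by blast
  then have "(\<lambda>k. b k + (\<Sum>i<k. e i)) \<longlonglongrightarrow> L + suminf e"
    using e(2) by (intro tendsto_add summable_LIMSEQ)
  then show ?thesis by (auto simp: b_def convergent_def)
qed

lemma bounded_bilinear_matrix_vector_mult:
  "bounded_bilinear ((*v) :: real^'n^'m \<Rightarrow> real^'n \<Rightarrow> real^'m)"
proof -
  have "bilinear ((*v) :: real^'n^'m \<Rightarrow> real^'n \<Rightarrow> real^'m)"
    unfolding bilinear_def
  proof (intro conjI allI)
    show "linear (\<lambda>A :: real^'n^'m. A *v y)" for y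
      by (rule linearI) (simp_all add: matrix_vector_mult_add_rdistrib scaleR_matrix_vector_assoc)
  qed simp
  then show ?thesis by (simp add: bilinear_conv_bounded_bilinear)
qed

lemma inner_matrix_vector_transpose:
  "inner (A *v u) w = inner u (transpose A *v w)" for A :: "real^'n^'m"
  by (metis dot_lmul_matrix inner_commute transpose_matrix_vector)

lemma C1_has_derivative:
  "continuously_differentiable F \<Longrightarrow> (F has_derivative (*v) (jacobian F (at x))) (at x)"
  by (simp add: continuously_differentiable_def jacobian_works)

text \<open>On a small ball the Jacobian is within \<open>e\<close> of its value at \<open>p\<close>
  in operator norm, and the mean value inequality applies to \<open>F\<close> minus its
  linearization. Neither of the two points has to be \<open>p\<close>, which is what a line search
  along a convergent sequence requires.\<close>

lemma C1_strict_derivative: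
  fixes F :: "real^'n \<Rightarrow> real^'m"
  assumes F: "continuously_differentiable F" and e: "e > 0"
  shows "\<exists>d>0. \<forall>y\<in>ball p d. \<forall>z\<in>ball p d.
           norm (F z - F y - jacobian F (at p) *v (z - y)) \<le> e * norm (z - y)"
proof -
  let ?J = "\<lambda>y. jacobian F (at y)"
  obtain B where B: "B > 0" "\<And>(A :: real^'n^'m) u. norm (A *v u) \<le> norm A * norm u * B"
    using bounded_bilinear.pos_bounded[OF bounded_bilinear_matrix_vector_mult] by blast
  have "isCont ?J p" using F by (auto simp: continuously_differentiable_def continuous_on_eq_continuous_at)
  then obtain d where d: "d > 0" "\<And>y. dist y p < d \<Longrightarrow> dist (?J y) (?J p) < e / B"
    using e B(1) unfolding continuous_at_eps_delta by (meson divide_pos_pos)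
  have on: "onorm ((*v) (?J y) - (*v) (?J p)) \<le> e" if "y \<in> ball p d" for y
  proof (rule onorm_le)
    fix u
    have "norm (?J y - ?J p) * B \<le> e"
      using d(2)[of y] that B(1) by (simp add: dist_norm norm_minus_commute field_simps less_imp_le)
    moreover have "norm ((?J y - ?J p) *v u) \<le> (norm (?J y - ?J p) * B) * norm u"
      using B(2)[of "?J y - ?J p" u] by (simp add: ac_simps)
    ultimately have "norm ((?J y - ?J p) *v u) \<le> e * norm u"
      by (meson mult_right_mono norm_ge_zero order_trans)
    then show "norm (((*v) (?J y) - (*v) (?J p)) u) \<le> e * norm u"
      by (simp add: matrix_vector_mult_diff_rdistrib)
  qed
  have "norm (F z - F y - ?J p *v (z - y)) \<le> norm (z - y) * e"
    if "y \<in> ball p d" "z \<in> ball p d" for y z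
  proof (rule differentiable_bound_linearization[where S = "ball p d" and f' = "\<lambda>y. (*v) (?J y)"])
    show "y + s *\<^sub>R (z - y) \<in> ball p d" if "s \<in> {0..1}" for s
    proof -
      have "(1 - s) *\<^sub>R y + s *\<^sub>R z \<in> ball p d"
        using that \<open>y \<in> ball p d\<close> \<open>z \<in> ball p d\<close> by (intro convexD_alt convex_ball) auto
      then show ?thesis by (simp add: algebra_simps)
    qed
  qed (use on d(1) C1_has_derivative[OF F] in \<open>auto intro: has_derivative_at_withinI\<close>)
  with d(1) show ?thesis by (auto simp: mult.commute)
qed

text \<open>The level set of \<open>F x\<close> is convex and contains both endpoints, so the
  negated difference quotients along the segment towards \<open>z\<close> lie in \<open>K\<close>;
  closedness passes this to their limit.\<close>

lemma quasiconvex_derivative: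
  assumes K: "closed K" "convex_cone K" and F: "continuously_differentiable F"
    and qc: "K_quasiconvex K F" and le: "cone_le K (F z) (F x)"
  shows "- (jacobian F (at x) *v (z - x)) \<in> K"
proof -
  let ?D = "jacobian F (at x) *v (z - x)"
  let ?d = "\<lambda>s. inverse s *\<^sub>R (F (x + s *\<^sub>R (z - x)) - F x)"
  have K0: "0 \<in> K" using K(2) by (auto simp: convex_cone_def conic_contains_0)
  have "(F has_derivative (*v) (jacobian F (at x))) (at (x + 0 *\<^sub>R (z - x)))"
    using C1_has_derivative[OF F, of x] by simp
  then have "((\<lambda>s. F (x + s *\<^sub>R (z - x))) has_derivative
      (\<lambda>s. jacobian F (at x) *v (s *\<^sub>R (z - x)))) (at 0)"
    by (rule has_derivative_compose[rotated]) (auto intro!: derivative_eq_intros)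
  then have "((\<lambda>s. norm (F (x + s *\<^sub>R (z - x)) - F x - s *\<^sub>R ?D) / norm s)
      \<longlongrightarrow> 0) (at 0)"
    by (simp add: has_derivative_at matrix_vector_mult_scaleR)
  moreover have "\<forall>\<^sub>F s in at 0.
      norm (F (x + s *\<^sub>R (z - x)) - F x - s *\<^sub>R ?D) / norm s = norm (?d s - ?D)"
    using eventually_neq_at_within[of 0]
  proof eventually_elim
    fix s :: real assume s: "s \<noteq> 0"
    have "?d s - ?D = inverse s *\<^sub>R (F (x + s *\<^sub>R (z - x)) - F x - s *\<^sub>R ?D)"
      using s by (simp add: scaleR_diff_right)
    then show "norm (F (x + s *\<^sub>R (z - x)) - F x - s *\<^sub>R ?D) / norm s = norm (?d s - ?D)"
      by (simp add: divide_inverse mult.commute)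
  qed
  ultimately have "((\<lambda>s. norm (?d s - ?D)) \<longlongrightarrow> 0) (at 0)"
    by (rule Lim_transform_eventually)
  then have "(?d \<longlongrightarrow> ?D) (at 0)"
    by (rule LIM_zero_cancel[OF tendsto_norm_zero_cancel])
  \<comment> \<open>Only positive \<open>s\<close> gives points of the segment, and only there is
    the sign of the quotients controlled.\<close>
  then have "(?d \<longlongrightarrow> ?D) (at_right 0)"
    by (rule tendsto_within_subset) simp
  then have lim: "((\<lambda>s. - ?d s) \<longlongrightarrow> - ?D) (at_right 0)"
    by (rule tendsto_minus)
  have "\<forall>\<^sub>F s in at_right 0. s \<in> {0<..<1::real}"
    by (rule eventually_at_right_real) simp
  then have "\<forall>\<^sub>F s in at_right 0. - ?d s \<in> K"
  proof eventually_elim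
    fix s :: real assume s: "s \<in> {0<..<1}"
    let ?L = "{u. cone_le K (F u) (F x)}"
    have "convex ?L" using qc by (simp add: K_quasiconvex_def)
    moreover have "x \<in> ?L" "z \<in> ?L" using le K0 by (auto simp: cone_le_def)
    ultimately have "(1 - s) *\<^sub>R x + s *\<^sub>R z \<in> ?L" using s by (intro convexD_alt) auto
    moreover have "(1 - s) *\<^sub>R x + s *\<^sub>R z = x + s *\<^sub>R (z - x)" by (simp add: algebra_simps)
    ultimately have "F x - F (x + s *\<^sub>R (z - x)) \<in> K" by (simp add: cone_le_def)
    then have "inverse s *\<^sub>R (F x - F (x + s *\<^sub>R (z - x))) \<in> K"
      using K(2) s by (simp add: convex_cone_def conic_def)
    then show "- ?d s \<in> K" by (metis minus_diff_eq scaleR_minus_right)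
  qed
  then show ?thesis
    using Lim_in_closed_set[OF K(1) _ _ lim] by simp
qed

theorem theorem4p1:
  fixes K G :: "(real^'m) set" and C :: "(real^'n) set"
    and F :: "real^'n \<Rightarrow> real^'m"
    and \<beta> \<delta> \<tau> \<sigma> :: real
    and x v :: "nat \<Rightarrow> real^'n" and t :: "nat \<Rightarrow> real"
  assumes "closed K" and "convex_cone K" and "pointed K" and "interior K \<noteq> {}"
    and "compact G" and "G \<subseteq> polar_cone K - {0}"
    and "polar_cone K = conic hull (convex hull G)"
    and "C \<noteq> {}" and "closed C" and "convex C"
    and "continuously_differentiable F"
    and "\<beta> > 0" and "0 < \<delta>" and "\<delta> < 1" and "\<tau> > 1" and "0 \<le> \<sigma>" and "\<sigma> < 1"
    and "inexact_projected_gradient K G C F \<beta> \<delta> \<tau> \<sigma> x v t"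
    and "{z \<in> C. \<forall>k. cone_le K (F z) (F (x k))} \<noteq> {}"
    and "\<exists>\<omega> :: nat \<Rightarrow> real^'m. \<forall>k. \<omega> k \<in> convex hull G \<and>
           v k = closest_point (shift C (x k))
                   (- (\<beta> *\<^sub>R (transpose (jacobian F (at (x k))) *v \<omega> k)))"
    and "K_quasiconvex K F"
  shows "\<exists>xs. stationary K C F xs \<and> x \<longlonglongrightarrow> xs"
proof -

  \<comment> \<open>Cone arithmetic, multipliers and a norm bound on the generators\<close>
  let ?J = "\<lambda>k. jacobian F (at (x k))"
  let ?p = "\<lambda>k. phi G (?J k *v v k)"
  note K = \<open>closed K\<close> \<open>convex_cone K\<close>
  note dual = mem_cone_iff_generator[OF K \<open>polar_cone K = conic hull (convex hull G)\<close>]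
  have Kscale: "c *\<^sub>R y \<in> K" if "c \<ge> 0" "y \<in> K" for c y
    using K(2) that by (auto simp: convex_cone_def conic_def)
  have K0: "0 \<in> K" using K(2) by (auto simp: convex_cone_def conic_contains_0)
  have Kadd: "a + b \<in> K" if "a \<in> K" "b \<in> K" for a b
    using K(2) that by (rule convex_cone_add)

  obtain \<omega> where \<omega>: "\<omega> k \<in> convex hull G"
    "v k = closest_point (shift C (x k)) (- (\<beta> *\<^sub>R (transpose (?J k) *v \<omega> k)))" for k
    using assms(20) by blast
  have "G \<noteq> {}" using \<omega>(1) by fastforce
  note G = \<open>compact G\<close> this
  obtain B where B: "B > 0" "G \<subseteq> cball 0 B"
    using compact_imp_bounded[OF G(1)] bounded_subset_ballD[of G 0] ball_subset_cball by blast
  have \<omega>B: "norm (\<omega> k) \<le> B" for k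
    using hull_minimal[OF B(2), of convex] \<omega>(1)[of k] by auto

  \<comment> \<open>Step sizes and feasibility of the iterates\<close>
  note run = assms(18)[unfolded inexact_projected_gradient_def]
  have x0: "x 0 \<in> C" and dir: "approx_direction G C F \<beta> \<sigma> (x k) (v k)"
    and h_neq: "hfun G F \<beta> (x k) (v k) \<noteq> 0" and x_Suc: "x (Suc k) = x k + t k *\<^sub>R v k" for k
    using run by auto
  obtain j :: "nat \<Rightarrow> nat" where j: "armijo K F \<delta> (x k) (v k) (\<tau> powi (- int (j k)))"
      "\<And>i. i < j k \<Longrightarrow> \<not> armijo K F \<delta> (x k) (v k) (\<tau> powi (- int i))"
      "t k = \<tau> powi (- int (j k))" for k
    using run by metis
  have t: "0 < t k" "t k \<le> 1" for k
    using \<open>\<tau> > 1\<close> by (auto simp: j(3) power_int_minus inverse_le_1_iff)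
  have v_mem: "x k + v k \<in> C" for k
    using dir[of k] by (auto simp: approx_direction_def)
  have x_mem: "x k \<in> C" for k
  proof (induction k)
    case (Suc k)
    have "(1 - t k) *\<^sub>R x k + t k *\<^sub>R (x k + v k) \<in> C"
      using \<open>convex C\<close> Suc v_mem t[of k] by (intro convexD_alt) auto
    then show ?case by (simp add: x_Suc algebra_simps)
  qed (use x0 in simp)

  \<comment> \<open>Strict descent along the approximate directions\<close>
  have theta_le: "theta G C F \<beta> (x k) \<le> hfun G F \<beta> (x k) u" if "x k + u \<in> C" for k u
  proof -
    have "u \<in> shift C (x k)" using that by (auto intro: image_eqI[where x = "x k + u"])
    then show ?thesis
      using theta_attained[OF G \<open>closed C\<close> x_mem \<open>\<beta> > 0\<close>] by metis
  qed
  \<comment> \<open>The zero direction is feasible, so \<open>theta\<close> is at most 0; the failed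
    stopping test then makes \<open>hfun\<close> strictly negative at \<open>v k\<close>.\<close>
  have "hfun G F \<beta> (x k) 0 = 0" for k
    using phi_attained[OF G, of 0] by (auto simp: hfun_def)
  then have "theta G C F \<beta> (x k) \<le> 0" for k
    using theta_le[of k 0] x_mem[of k] by simp
  then have "hfun G F \<beta> (x k) (v k) \<le> 0" for k
    using dir[of k] \<open>\<sigma> < 1\<close> unfolding approx_direction_def
    by (meson diff_ge_0_iff_ge less_imp_le mult_nonneg_nonpos order_trans)
  then have h_neg: "\<beta> * ?p k + (norm (v k))\<^sup>2 / 2 < 0" for k
    using h_neq[of k] by (simp add: hfun_def order_less_le)
  have p_neg: "?p k < 0" for k
  proof -
    have "\<beta> * ?p k < 0" using h_neg[of k] by (smt (verit) zero_le_power2 divide_nonneg_pos)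
    then show ?thesis using \<open>\<beta> > 0\<close> by (simp add: mult_less_0_iff)
  qed
  have Jv: "- (?J k *v v k) \<in> K" for k
    using phi_upper[OF G(1), of _ "?J k *v v k"] p_neg[of k] by (force simp: dual)

  \<comment> \<open>Summability of the scaled decrements\<close>
  define y where "y k = t k *\<^sub>R (- (?J k *v v k))" for k
  have y: "y k \<in> K" for k unfolding y_def using t(1)[of k] Jv by (intro Kscale) auto
  have descent: "F (x k) - F (x (Suc k)) - \<delta> *\<^sub>R y k \<in> K" for k
    using j(1)[of k] by (simp add: armijo_def cone_le_def x_Suc j(3)[symmetric] y_def algebra_simps)
  have decr: "F (x k) - F (x (Suc k)) \<in> K" for k
    using Kadd[OF descent[of k] Kscale[OF _ y[of k], of \<delta>]] \<open>0 < \<delta>\<close> by simp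
  obtain z where z: "z \<in> C" "\<And>k. cone_le K (F z) (F (x k))" using assms(19) by blast

  have sum_y: "summable (\<lambda>k. norm (y k))"
  proof -
    obtain w c where w: "c > 0" "w \<in> polar_cone K" "\<And>y. y \<in> K \<Longrightarrow> c * norm y \<le> inner y w"
      using pointed_coercive_functional[OF K \<open>pointed K\<close>] by blast
    \<comment> \<open>Pairing the line search inequality with the coercive functional
      \<open>w\<close> bounds \<open>norm (y k)\<close> by a telescoping difference; the value at
      \<open>z\<close> bounds the sums from below the last term.\<close>
    have y_le: "norm (y k) \<le> (inner (F (x k)) w - inner (F (x (Suc k))) w) / (\<delta> * c)" for k
    proof -
      have "0 \<le> inner (F (x k) - F (x (Suc k)) - \<delta> *\<^sub>R y k) w"
        using polar_coneD[OF w(2) descent] .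
      moreover have "\<delta> * (c * norm (y k)) \<le> \<delta> * inner (y k) w"
        using w(3)[OF y[of k]] \<open>0 < \<delta>\<close> by (intro mult_left_mono) auto
      ultimately have "\<delta> * (c * norm (y k)) \<le> inner (F (x k)) w - inner (F (x (Suc k))) w"
        by (simp add: inner_diff_left)
      then show ?thesis
        using w(1) \<open>0 < \<delta>\<close> by (simp add: pos_le_divide_eq ac_simps)
    qed
    have "(\<Sum>k<n. norm (y k)) \<le> (inner (F (x 0)) w - inner (F z) w) / (\<delta> * c)" for n
    proof -
      have "(\<Sum>k<n. norm (y k)) \<le> (\<Sum>k<n. (inner (F (x k)) w - inner (F (x (Suc k))) w) / (\<delta> * c))"
        by (intro sum_mono y_le)
      also have "\<dots> = (inner (F (x 0)) w - inner (F (x n)) w) / (\<delta> * c)"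
        using sum_lessThan_telescope'[of "\<lambda>k. inner (F (x k)) w" n]
        by (simp flip: sum_divide_distrib)
      also have "\<dots> \<le> (inner (F (x 0)) w - inner (F z) w) / (\<delta> * c)"
        using polar_coneD[OF w(2), of "F (x n) - F z"] z(2)[of n] w(1) \<open>0 < \<delta>\<close>
        by (intro divide_right_mono) (auto simp: cone_le_def inner_diff_left)
      finally show ?thesis .
    qed
    then show ?thesis by (intro summableI_nonneg_bounded) auto
  qed

  have fejer: "convergent (\<lambda>k. (norm (x k - u))\<^sup>2)"
    if u: "u \<in> C" "\<And>k. cone_le K (F u) (F (x k))" for u
  proof (rule quasi_decreasing_convergent)
    show "summable (\<lambda>k. 2 * \<beta> * B * norm (y k))" using sum_y by (rule summable_mult)
    show "0 \<le> 2 * \<beta> * B * norm (y k)" for k using \<open>\<beta> > 0\<close> B(1) by simp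
    fix k
    let ?v = "v k" and ?d = "u - x k"
    define g where "g = - (\<beta> *\<^sub>R (transpose (?J k) *v \<omega> k))"
    have "convex (shift C (x k))" "closed (shift C (x k))"
      using convex_translation[OF \<open>convex C\<close>, of "- x k"] closed_translation[OF \<open>closed C\<close>, of "- x k"]
      by simp_all
    moreover have "?d \<in> shift C (x k)" using u(1) by blast
    \<comment> \<open>The obtuse angle property of the projection of \<open>g\<close>, tested at the
      feasible direction towards \<open>u\<close>.\<close>
    ultimately have proj: "inner (g - ?v) (?d - ?v) \<le> 0"
      using closest_point_dot[of "shift C (x k)" ?d g] \<omega>(2)[of k] by (simp add: g_def)
    have inner_g: "inner g a = - \<beta> * inner (?J k *v a) (\<omega> k)" for a
      unfolding g_def inner_matrix_vector_transpose by (simp add: inner_commute)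
    have "- (?J k *v ?d) \<in> K"
      by (rule quasiconvex_derivative[OF K assms(11) assms(21) u(2)])
    moreover have "\<omega> k \<in> polar_cone K"
      using \<omega>(1) hull_subset[of "convex hull G" conic] assms(7) by auto
    ultimately have "0 \<le> inner (- (?J k *v ?d)) (\<omega> k)" by (intro polar_coneD)
    then have g_d: "0 \<le> inner g ?d" using \<open>\<beta> > 0\<close> by (simp add: inner_g mult_nonneg_nonneg mult_le_0_iff)
    have "inner g ?d - inner g ?v - inner ?v ?d + (norm ?v)\<^sup>2 \<le> 0"
      using proj by (simp only: inner_diff_left inner_diff_right power2_norm_eq_inner)
    with g_d have vd: "(norm ?v)\<^sup>2 - inner g ?v \<le> inner ?v ?d" by linarith
    have "(norm (x (Suc k) - u))\<^sup>2 = (norm (x k - u))\<^sup>2 - 2 * t k * inner ?v ?d + (t k)\<^sup>2 * (norm ?v)\<^sup>2"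
      unfolding x_Suc power2_norm_eq_inner
      by (simp add: inner_commute algebra_simps power2_eq_square)
    also have "\<dots> \<le> (norm (x k - u))\<^sup>2 - 2 * t k * ((norm ?v)\<^sup>2 - inner g ?v) + 2 * t k * (norm ?v)\<^sup>2"
    proof -
      \<comment> \<open>This crude bound, from \<open>t k \<le> 1\<close>, is enough: the two terms
        in \<open>(norm ?v)\<^sup>2\<close> then cancel and only \<open>2 * t k * inner g ?v\<close>
        is left, which is \<open>2 * \<beta> * inner (y k) (\<omega> k)\<close>.\<close>
      have "(t k)\<^sup>2 \<le> 2 * t k" using t[of k] by (simp add: power2_eq_square mult_right_mono)
      then have "(t k)\<^sup>2 * (norm ?v)\<^sup>2 \<le> 2 * t k * (norm ?v)\<^sup>2" by (rule mult_right_mono) simp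
      moreover have "2 * t k * ((norm ?v)\<^sup>2 - inner g ?v) \<le> 2 * t k * inner ?v ?d"
        using vd t(1)[of k] by (intro mult_left_mono) auto
      ultimately show ?thesis by linarith
    qed
    also have "\<dots> = (norm (x k - u))\<^sup>2 + 2 * \<beta> * inner (y k) (\<omega> k)"
      by (simp add: inner_g y_def algebra_simps)
    also have "inner (y k) (\<omega> k) \<le> B * norm (y k)"
      using Cauchy_Schwarz_ineq2[of "y k" "\<omega> k"] mult_left_mono[OF \<omega>B[of k] norm_ge_zero[of "y k"]]
      by (simp add: mult.commute)
    then have "(norm (x k - u))\<^sup>2 + 2 * \<beta> * inner (y k) (\<omega> k)
        \<le> (norm (x k - u))\<^sup>2 + 2 * \<beta> * B * norm (y k)"
      using \<open>\<beta> > 0\<close> by simp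
    finally show "(norm (x (Suc k) - u))\<^sup>2 \<le> (norm (x k - u))\<^sup>2 + 2 * \<beta> * B * norm (y k)" .
  qed simp

  \<comment> \<open>A cluster point and convergence of the whole sequence\<close>
  have F_decr: "F (x k) - F (x (k + n)) \<in> K" for k n
  proof (induction n)
    case (Suc n)
    then show ?case using Kadd[OF Suc decr[of "k + n"]] by simp
  qed (use K0 in simp)
  have contF: "isCont F p" for p
    using C1_has_derivative[OF assms(11)] has_derivative_continuous by blast

  have "bounded (range x)"
  proof -
    obtain M where M: "\<And>k. norm ((norm (x k - z))\<^sup>2) \<le> M"
      using convergent_imp_Bseq[OF fejer[OF z]] by (auto simp: Bseq_def)
    have "norm (x k) \<le> norm z + sqrt M" for k
    proof -
      have "norm (x k - z) \<le> sqrt M" using M[of k] by (intro real_le_rsqrt) simp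
      then show ?thesis using norm_triangle_sub[of "x k" z] by linarith
    qed
    then show ?thesis by (auto simp: bounded_iff)
  qed
  then obtain xs r where r: "strict_mono (r :: nat \<Rightarrow> nat)" "(x \<circ> r) \<longlonglongrightarrow> xs"
    using bounded_imp_convergent_subsequence by metis
  have xs: "xs \<in> C"
    using closed_sequentially[OF \<open>closed C\<close> _ r(2)] x_mem by simp
  \<comment> \<open>The values of \<open>F\<close> decrease along the sequence, so later members of
    the subsequence lie below \<open>F (x k)\<close>, and so does their limit. Hence
    \<open>fejer\<close> applies to \<open>xs\<close> itself, and the subsequence identifies the
    limit of the distances as 0.\<close>
  have "F (x k) - F xs \<in> K" for k
  proof (rule Lim_in_closed_set[OF K(1) _ _ ])
    show "(\<lambda>i. F (x k) - F ((x \<circ> r) i)) \<longlonglongrightarrow> F (x k) - F xs"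
      using isCont_tendsto_compose[OF contF r(2)] by (intro tendsto_diff tendsto_const)
    show "\<forall>\<^sub>F i in sequentially. F (x k) - F ((x \<circ> r) i) \<in> K"
      using eventually_ge_at_top[of k]
    proof eventually_elim
      fix i assume "k \<le> i"
      then have "k \<le> r i" using seq_suble[OF r(1), of i] by linarith
      then show "F (x k) - F ((x \<circ> r) i) \<in> K" using F_decr[of k "r i - k"] by simp
    qed
  qed simp
  then obtain L where L: "(\<lambda>k. (norm (x k - xs))\<^sup>2) \<longlonglongrightarrow> L"
    using fejer[OF xs] by (auto simp: cone_le_def convergent_def)
  have "(\<lambda>i. (norm ((x \<circ> r) i - xs))\<^sup>2) \<longlonglongrightarrow> (norm (xs - xs))\<^sup>2"
    using r(2) by (intro tendsto_intros)
  then have "L = 0"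
    using LIMSEQ_unique[OF LIMSEQ_subseq_LIMSEQ[OF L r(1)]] by (simp add: o_def)
  then have "(\<lambda>k. norm (x k - xs)) \<longlonglongrightarrow> 0"
    using tendsto_real_sqrt[OF L] by simp
  then have lim: "x \<longlonglongrightarrow> xs" by (rule LIM_zero_cancel[OF tendsto_norm_zero_cancel])

  \<comment> \<open>Convergence of the Jacobians and boundedness of the directions\<close>
  note bb = bounded_bilinear_matrix_vector_mult
  let ?Js = "jacobian F (at xs)"
  have limJ: "?J \<longlonglongrightarrow> ?Js"
    using assms(11) lim unfolding continuously_differentiable_def continuous_on_eq_continuous_at[OF open_UNIV]
    by (auto intro: isCont_tendsto_compose)
  have contphi: "isCont (phi G) a" for a
    using continuous_on_phi[OF G] by (simp add: continuous_on_eq_continuous_at)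

  have vbound: "\<exists>M>0. \<forall>k. norm (v k) \<le> M"
  proof -
    obtain D where D: "D > 0" "\<And>(A :: real^'n^'m) u. norm (A *v u) \<le> norm A * norm u * D"
      using bounded_bilinear.pos_bounded[OF bb] by blast
    obtain N where N: "N > 0" "\<And>k. norm (?J k) \<le> N"
      using convergent_imp_Bseq[OF convergentI[OF limJ]] by (auto simp: Bseq_def)
    obtain w where w: "w \<in> G" using G(2) by blast
    have "norm (v k) \<le> 2 * \<beta> * (N * D * B)" for k
    proof (cases "v k = 0")
      case False
      have "norm (?J k *v v k) \<le> N * norm (v k) * D"
        by (rule order_trans[OF D(2)]) (use N D(1) in \<open>auto intro!: mult_right_mono\<close>)
      moreover have "norm w \<le> B" using w B(2) by auto
      ultimately have "\<bar>inner (?J k *v v k) w\<bar> \<le> N * norm (v k) * D * B"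
        by (intro order_trans[OF Cauchy_Schwarz_ineq2] mult_mono) (use N(1) D(1) in auto)
      then have "- (N * norm (v k) * D * B) \<le> ?p k"
        using phi_upper[OF G(1) w, of "?J k *v v k"] by linarith
      then have "\<beta> * - (N * norm (v k) * D * B) \<le> \<beta> * ?p k"
        using \<open>\<beta> > 0\<close> by (intro mult_left_mono) auto
      \<comment> \<open>Negativity of \<open>hfun\<close> dominates the square of
        \<open>norm (v k)\<close> by a term linear in \<open>norm (v k)\<close>; one factor can be
        cancelled.\<close>
      with h_neg[of k] have "(norm (v k))\<^sup>2 \<le> 2 * \<beta> * (N * D * B) * norm (v k)"
        by (simp add: algebra_simps)
      with False show ?thesis by (simp add: power2_eq_square)
    qed (use \<open>\<beta> > 0\<close> N(1) D(1) B(1) in simp)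
    moreover have "2 * \<beta> * (N * D * B) > 0" using \<open>\<beta> > 0\<close> N(1) D(1) B(1) by simp
    ultimately show ?thesis by blast
  qed
  then obtain M where M: "M > 0" "\<And>k. norm (v k) \<le> M" by blast

  \<comment> \<open>Stationarity of the limit\<close>
  have "stationary K C F xs"
  proof (rule ccontr)
    assume "\<not> stationary K C F xs"
    then obtain b where b: "b \<in> uminus ` interior K" "b \<in> (\<lambda>v. ?Js *v v) ` shift C xs"
      using xs unfolding stationary_def by blast
    from b(2) obtain u where u_mem: "u \<in> C" and b_eq: "b = ?Js *v (u - xs)" by blast
    from b(1) have "- b \<in> interior K" by force
    with u_mem b_eq have u: "u \<in> C" "- (?Js *v (u - xs)) \<in> interior K" by simp_all
    let ?d = "u - xs"
    define q where "q = phi G (?Js *v ?d)"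
    \<comment> \<open>The step \<open>s\<close> is small enough that the quadratic term of
      \<open>hfun\<close> consumes at most half of the linear decrease
      \<open>- \<beta> * s * q\<close>; the other half is \<open>e\<close>. The added 1 keeps the
      denominator positive. The constant \<open>c\<close> is what remains for \<open>- phi\<close>
      after passing from the limit to \<open>x k\<close> (factor 1/2), the inexactness factor
      \<open>1 - \<sigma>\<close> and division by \<open>\<beta>\<close>.\<close>
    define s where "s = min 1 (- \<beta> * q / ((norm ?d)\<^sup>2 + 1))"
    define e where "e = - \<beta> * s * q / 2"
    define c where "c = (1 - \<sigma>) * (e / 2) / \<beta>"
    let ?u = "xs + s *\<^sub>R ?d"
    have "q < 0" unfolding q_def using phi_neg_if_interior[OF G assms(6) u(2)] .
    then have bq: "0 < - \<beta> * q" using \<open>\<beta> > 0\<close> by (simp add: mult_pos_neg)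
    have N: "0 < (norm ?d)\<^sup>2 + 1" by (simp add: add_nonneg_pos)
    have s: "0 < s" "s \<le> 1" using divide_pos_pos[OF bq N] by (auto simp: s_def)
    have "s \<le> - \<beta> * q / ((norm ?d)\<^sup>2 + 1)" by (simp add: s_def)
    then have s_le: "s * ((norm ?d)\<^sup>2 + 1) \<le> - \<beta> * q" using pos_le_divide_eq[OF N] by blast
    have e: "e > 0" using mult_pos_pos[OF s(1) bq] by (simp add: e_def ac_simps)
    have c: "c > 0" using e \<open>\<sigma> < 1\<close> \<open>\<beta> > 0\<close> by (simp add: c_def)
    have "(1 - s) *\<^sub>R xs + s *\<^sub>R u \<in> C"
      using \<open>convex C\<close> xs u(1) s by (intro convexD_alt) auto
    then have us_mem: "?u \<in> C" by (simp add: algebra_simps)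

    \<comment> \<open>Uniform decrease near a nonstationary limit\<close>
    have "hfun G F \<beta> xs (s *\<^sub>R ?d) \<le> - e"
    proof -
      obtain w where w: "w \<in> G" "phi G (s *\<^sub>R (?Js *v ?d)) = inner (s *\<^sub>R (?Js *v ?d)) w"
        using phi_attained[OF G] by blast
      have "phi G (?Js *v (s *\<^sub>R ?d)) \<le> s * q"
        using w(2) phi_upper[OF G(1) w(1), of "?Js *v ?d"] s(1)
        by (simp add: matrix_vector_mult_scaleR q_def)
      then have "\<beta> * phi G (?Js *v (s *\<^sub>R ?d)) \<le> \<beta> * (s * q)"
        using \<open>\<beta> > 0\<close> by simp
      moreover have "s * (s * (norm ?d)\<^sup>2) \<le> s * (- \<beta> * q)"
        using s s_le by (intro mult_left_mono) (auto simp: algebra_simps)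
      then have "(norm (s *\<^sub>R ?d))\<^sup>2 \<le> - \<beta> * s * q"
        by (simp add: power_mult_distrib power2_eq_square ac_simps)
      ultimately show ?thesis by (simp add: hfun_def e_def)
    qed
    \<comment> \<open>Aiming from every \<open>x k\<close> at the same feasible point
      \<open>?u\<close> gives an upper bound on \<open>theta\<close> from continuity of
      \<open>hfun\<close> alone.\<close>
    moreover have "(\<lambda>k. hfun G F \<beta> (x k) (?u - x k)) \<longlonglongrightarrow> hfun G F \<beta> xs (?u - xs)"
      unfolding hfun_def
      by (intro tendsto_intros isCont_tendsto_compose[OF contphi] bounded_bilinear.tendsto[OF bb] limJ lim) simp
    ultimately have "\<forall>\<^sub>F k in sequentially. hfun G F \<beta> (x k) (?u - x k) < - e / 2"
      using e by (intro order_tendstoD(2)) auto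
    then have p_le: "\<forall>\<^sub>F k in sequentially. ?p k \<le> - c"
    proof eventually_elim
      fix k assume "hfun G F \<beta> (x k) (?u - x k) < - e / 2"
      then have "theta G C F \<beta> (x k) \<le> - e / 2" using theta_le[of k "?u - x k"] us_mem by simp
      then have "(1 - \<sigma>) * theta G C F \<beta> (x k) \<le> (1 - \<sigma>) * (- e / 2)"
        using \<open>\<sigma> < 1\<close> by (intro mult_left_mono) auto
      then have "hfun G F \<beta> (x k) (v k) \<le> (1 - \<sigma>) * (- e / 2)"
        using dir[of k] by (simp add: approx_direction_def)
      then have "\<beta> * ?p k \<le> (1 - \<sigma>) * (- e / 2)"
        unfolding hfun_def by (smt (verit) zero_le_power2 divide_nonneg_pos)
      then show "?p k \<le> - c" using \<open>\<beta> > 0\<close> by (simp add: c_def field_simps)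
    qed

    \<comment> \<open>Vanishing step sizes\<close>
    have t_lim: "t \<longlonglongrightarrow> 0"
    proof (rule tendsto_sandwich[OF _ _ tendsto_const])
      show "\<forall>\<^sub>F k in sequentially. 0 \<le> t k" using t(1) by (simp add: less_imp_le)
      show "(\<lambda>k. B * norm (y k) / c) \<longlonglongrightarrow> 0"
        using tendsto_divide[OF tendsto_mult_left[OF summable_LIMSEQ_zero[OF sum_y]] tendsto_const, of c B] c by simp
      show "\<forall>\<^sub>F k in sequentially. t k \<le> B * norm (y k) / c"
        using p_le
      proof eventually_elim
        fix k assume p: "?p k \<le> - c"
        \<comment> \<open>Any single generator will do, because \<open>phi\<close> bounds all
          pairings from above: \<open>inner (y k) w\<close> is at least
          \<open>t k * c\<close>.\<close>
        obtain w where w: "w \<in> G" using G(2) by blast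
        have "t k * c \<le> t k * - inner (?J k *v v k) w"
          using p phi_upper[OF G(1) w, of "?J k *v v k"] t(1)[of k] by (intro mult_left_mono) auto
        also have "\<dots> = inner (y k) w" by (simp add: y_def)
        also have "\<dots> \<le> norm (y k) * B"
          using Cauchy_Schwarz_ineq2[of "y k" w] mult_left_mono[of "norm w" B "norm (y k)"] w B(2) by auto
        finally show "t k \<le> B * norm (y k) / c" using c by (simp add: field_simps)
      qed
    qed

    \<comment> \<open>Acceptance of the rejected trial step\<close>
    define \<epsilon> where "\<epsilon> = (1 - \<delta>) * c / (2 * B * M)"
    \<comment> \<open>Two errors of size \<open>\<epsilon> * ?s * M\<close> will arise, and pairing
      with a generator costs a factor \<open>B\<close>; the total is then exactly the slack
      \<open>?s * (1 - \<delta>) * c\<close> in the line search.\<close>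
    have \<epsilon>: "\<epsilon> > 0" using c B(1) M(1) \<open>\<delta> < 1\<close> by (simp add: \<epsilon>_def)
    obtain d where d: "d > 0" "\<And>a b. a \<in> ball xs d \<Longrightarrow> b \<in> ball xs d \<Longrightarrow>
        norm (F b - F a - ?Js *v (b - a)) \<le> \<epsilon> * norm (b - a)"
      using C1_strict_derivative[OF assms(11) \<epsilon>, of xs] by blast
    have "(\<lambda>k. norm (?Js - ?J k)) \<longlonglongrightarrow> norm (?Js - ?Js)" using limJ by (intro tendsto_intros)
    moreover obtain D where D: "D > 0" "\<And>(A :: real^'n^'m) u. norm (A *v u) \<le> norm A * norm u * D"
      using bounded_bilinear.pos_bounded[OF bb] by blast
    ultimately have "\<forall>\<^sub>F k in sequentially. norm (?Js - ?J k) < \<epsilon> / D"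
      using \<epsilon> by (intro order_tendstoD(2)) auto
    moreover have "\<forall>\<^sub>F k in sequentially. dist (x k) xs < d / 2"
      using lim d(1) by (intro tendstoD) auto
    \<comment> \<open>The bound 1 forces at least one rejected trial; the other bound keeps the
      trial point with step \<open>\<tau> * t k\<close> within \<open>d / 2\<close> of
      \<open>x k\<close>.\<close>
    moreover have "\<forall>\<^sub>F k in sequentially. t k < min 1 (d / (2 * \<tau> * M))"
      using t_lim d(1) M(1) \<open>\<tau> > 1\<close> by (intro order_tendstoD(2)) auto
    ultimately have "\<forall>\<^sub>F k in sequentially. ?p k \<le> - c \<and> norm (?Js - ?J k) < \<epsilon> / D \<and>
        dist (x k) xs < d / 2 \<and> t k < min 1 (d / (2 * \<tau> * M))"
      using p_le by eventually_elim blast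
    then obtain k where k: "?p k \<le> - c" "norm (?Js - ?J k) < \<epsilon> / D" "dist (x k) xs < d / 2"
        "t k < 1" "t k < d / (2 * \<tau> * M)"
      using eventually_happens'[OF sequentially_bot] by force

    let ?s = "\<tau> * t k" and ?Jv = "?J k *v v k"
    have s_pos: "?s > 0" using t(1)[of k] \<open>\<tau> > 1\<close> by simp
    have "j k \<noteq> 0" using k(4) j(3)[of k] by (cases "j k") auto
    then obtain i where i: "j k = Suc i" using not0_implies_Suc by blast
    \<comment> \<open>The exponent \<open>i\<close> just before the accepted one corresponds to the
      step \<open>\<tau> * t k\<close>, rejected by minimality of \<open>j k\<close>.\<close>
    have "t k = inverse (\<tau> ^ Suc i)"
      using j(3)[of k] unfolding i by (simp only: power_int_minus power_int_of_nat)
    then have "\<tau> powi (- int i) = ?s"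
      using \<open>\<tau> > 1\<close> by (simp add: power_int_minus)
    then have no_armijo: "\<not> armijo K F \<delta> (x k) (v k) ?s" using j(2)[of i k] i by simp

    let ?b = "x k + ?s *\<^sub>R v k"
    define \<rho> where "\<rho> = F ?b - F (x k) - ?s *\<^sub>R ?Jv"
    have sv: "norm (?s *\<^sub>R v k) \<le> ?s * M"
      using M(2)[of k] s_pos by (simp add: mult_left_mono)
    have "?s * M < d / 2" using k(5) M(1) \<open>\<tau> > 1\<close> by (simp add: field_simps)
    with sv have "norm (?s *\<^sub>R v k) < d / 2" by linarith
    then have "?b \<in> ball xs d"
      using k(3) norm_triangle_ineq[of "x k - xs" "?s *\<^sub>R v k"]
      by (simp add: dist_norm norm_minus_commute algebra_simps)
    moreover have "x k \<in> ball xs d" using k(3) d(1) by (simp add: dist_commute)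
    ultimately have "norm (F ?b - F (x k) - ?Js *v (?b - x k)) \<le> \<epsilon> * norm (?b - x k)"
      by (intro d(2))
    then have "norm (F ?b - F (x k) - ?s *\<^sub>R (?Js *v v k)) \<le> \<epsilon> * (?s * M)"
      using order_trans[OF _ mult_left_mono[OF sv less_imp_le[OF \<epsilon>]]] by (simp add: matrix_vector_mult_scaleR)
    moreover have "norm ((?Js - ?J k) *v v k) \<le> \<epsilon> * M"
    proof -
      have "norm (?Js - ?J k) * D \<le> \<epsilon>" using k(2) D(1) by (simp add: field_simps)
      then have "(norm (?Js - ?J k) * D) * norm (v k) \<le> \<epsilon> * M"
        using M(2)[of k] \<epsilon> by (intro mult_mono) auto
      then show ?thesis using D(2)[of "?Js - ?J k" "v k"] by (simp add: ac_simps)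
    qed
    then have "norm (?s *\<^sub>R ((?Js - ?J k) *v v k)) \<le> ?s * (\<epsilon> * M)"
      using mult_left_mono[OF _ less_imp_le[OF s_pos]] abs_of_pos[OF s_pos] by (simp only: norm_scaleR)
    \<comment> \<open>The remainder at \<open>x k\<close> splits into the linearization error with
      the Jacobian at \<open>xs\<close> and the change of Jacobian from \<open>x k\<close> to
      \<open>xs\<close>.\<close>
    moreover have "\<rho> = (F ?b - F (x k) - ?s *\<^sub>R (?Js *v v k)) + ?s *\<^sub>R ((?Js - ?J k) *v v k)"
      by (simp add: \<rho>_def matrix_vector_mult_diff_rdistrib scaleR_diff_right)
    ultimately have "norm \<rho> \<le> \<epsilon> * (?s * M) + ?s * (\<epsilon> * M)"
      using norm_triangle_mono by metis
    also have "\<dots> = ?s * ((1 - \<delta>) * c / B)"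
      using M(1) B(1) by (simp add: \<epsilon>_def field_simps)
    finally have \<rho>: "norm \<rho> * B \<le> ?s * ((1 - \<delta>) * c)"
      using B(1) by (simp add: pos_le_divide_eq)
    \<comment> \<open>Since \<delta> < 1, a part \<open>?s * (1 - \<delta>)\<close> of the linear
      decrease is left over; against each generator it outweighs the remainder.\<close>
    have "0 \<le> inner (F (x k) + (\<delta> * ?s) *\<^sub>R ?Jv - F ?b) w" if w: "w \<in> G" for w
    proof -
      have "inner \<rho> w \<le> norm \<rho> * B"
        using Cauchy_Schwarz_ineq2[of \<rho> w] mult_left_mono[of "norm w" B "norm \<rho>"] w B(2) by auto
      moreover have "c \<le> - inner ?Jv w" using phi_upper[OF G(1) w, of ?Jv] k(1) by linarith
      then have "(?s * (1 - \<delta>)) * c \<le> (?s * (1 - \<delta>)) * - inner ?Jv w"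
        using s_pos \<open>\<delta> < 1\<close> by (intro mult_left_mono) auto
      moreover have "F (x k) + (\<delta> * ?s) *\<^sub>R ?Jv - F ?b = - \<rho> - (?s * (1 - \<delta>)) *\<^sub>R ?Jv"
        by (simp add: \<rho>_def algebra_simps)
      ultimately show ?thesis using \<rho> by (simp add: inner_diff_left)
    qed
    then have "armijo K F \<delta> (x k) (v k) ?s" by (simp add: armijo_def cone_le_def dual)
    with no_armijo show False ..
  qed
  with lim show ?thesis by blast
qed

end
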